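(* Let $m\ge 0$ be an integer and let $f:\mathbb{R}\to\mathbb{R}$ satisfy the Fréchet functional equation $$\Delta_h^{m+1}f(x)=0\quad\text{for all }(x,h)\in\mathbb{R}^2,$$ and suppose that $f$ is not an ordinary polynomial. Then: (1) $f$ is not bounded on any nonempty open interval; (2) for every $x\in\mathbb{R}$ there exists an unbounded interval $I_x\subseteq\mathbb{R}$ such that $\{x\}\times I_x\subseteq \overline{G(f)}^{\mathbb{R}^2}$; (3) $\overline{G(f)}^{\mathbb{R}^2}$ contains an unbounded open set (open in $\mathbb{R}^2$).
   Context: For $f:\mathbb{R}\to\mathbb{R}$ and $x,h\in\mathbb{R}$, $\Delta_h f(x)=f(x+h)-f(x)$, and $\Delta_h^{s}$ is the $s$-fold iterate of $\Delta_h$, so that $\Delta_h^{m+1}f(x)=\sum_{k=0}^{m+1}\binom{m+1}{k}(-1)^{m+1-k}f(x+kh)$. $G(f)=\{(x,f(x)):x\in\mathbb{R}\}$ is the graph of $f$ and $\overline{G(f)}^{\mathbb{R}^2}$ its topological closure in $\mathbb{R}^2$. An ordinary polynomial is a function of the form $x\mapsto a_0+a_1x+\cdots+a_dx^d$ with real coefficients. *)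

theory Defs
  imports "HOL-Analysis.Analysis" "HOL-Computational_Algebra.Polynomial"
begin

definition forward_diff :: "real \<Rightarrow> (real \<Rightarrow> real) \<Rightarrow> real \<Rightarrow> real" where
  "forward_diff h f = (\<lambda>x. f (x + h) - f x)"

definition function_graph :: "(real \<Rightarrow> real) \<Rightarrow> (real \<times> real) set" where
  "function_graph f = {(x, f x) | x. x \<in> UNIV}"

definition ordinary_polynomial :: "(real \<Rightarrow> real) \<Rightarrow> bool" where
  "ordinary_polynomial f \<longleftrightarrow> (\<exists>p :: real poly. f = poly p)"

end

theory Submission
  imports Defs
begin

text \<open>A solution of the Frechet equation of order \<open>m + 1\<close> is a polynomial along every rational line:
  the Newton formula gives \<open>f (x + q * h)\<close> as one polynomial in \<open>q\<close> for all rational \<open>q\<close>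
  (\<open>newton_poly_Rats\<close>). Using it for the steps \<open>1\<close> and \<open>h\<close> together gives a polynomial \<open>F\<close> in two
  variables with \<open>f (q + r * h) = F q r\<close> for rational \<open>q\<close> and \<open>r\<close>. Since \<open>F\<close> is continuous and
  rational points are dense in the plane, the closure of the graph contains \<open>(q + r * h, F q r)\<close>
  for all real \<open>q\<close> and \<open>r\<close> (\<open>plane_fun_in_closure\<close>). The real pairs with \<open>q + r * h = t\<close> form a
  whole line, so above \<open>t\<close> the closure contains all values of the polynomial \<open>r \<mapsto> F (t - r * h) r\<close>.

  Let \<open>p\<close> be the polynomial that agrees with \<open>f\<close> on the rationals; then \<open>F t 0 = p t\<close>. As \<open>f\<close> is not
  a polynomial, some \<open>h\<close> has \<open>f h \<noteq> p h\<close>, and \<open>h\<close> is fixed in this way. The polynomial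
  \<open>r \<mapsto> F (t - r * h) r\<close> has the value \<open>p t\<close> at \<open>r = 0\<close>. Where it is not constant, its range contains a
  half-line starting at \<open>p t\<close>. If it were constant for infinitely many \<open>t\<close>, then the identity
  \<open>F (t - h) 1 = p t\<close>, polynomial in \<open>t\<close>, would hold for all \<open>t\<close>, and \<open>t = h\<close> would give
  \<open>f h = F 0 1 = p h\<close>. So for a dense set of \<open>t\<close> the closure contains the upward or the downward
  half-line from \<open>(t, p t)\<close>. The set of \<open>t\<close> with an upward half-line and the set with a downward one
  are both closed, so they cover the whole real line (\<open>half_line_sets_cover\<close>).

  This is the second claim. It implies the first, because a bound of \<open>f\<close> on an open set also bounds
  the closure of the graph above that set. For the third, one of two closed sets covering the real
  line contains a nonempty open set \<open>V\<close>, and the part of \<open>V \<times> UNIV\<close> strictly above, or strictly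
  below, the graph of \<open>p\<close> is an unbounded open subset of the closure.\<close>

section \<open>Newton interpolation along an arithmetic progression\<close>

definition binomial_poly :: "nat \<Rightarrow> real poly" where
  "binomial_poly k = smult (1 / fact k) (\<Prod>i=0..<k. [:- of_nat i, 1:])"

lemma poly_binomial_poly: "poly (binomial_poly k) x = x gchoose k"
  by (simp add: binomial_poly_def gbinomial_prod_rev poly_prod)

text \<open>The polynomial in \<open>q\<close> that Newton's forward difference formula, cut off after order \<open>m\<close>, gives for
  \<open>f (x + q * h)\<close>.\<close>

definition newton_poly :: "nat \<Rightarrow> real \<Rightarrow> (real \<Rightarrow> real) \<Rightarrow> real \<Rightarrow> real poly" where
  "newton_poly m h f x = (\<Sum>k\<le>m. smult ((forward_diff h ^^ k) f x) (binomial_poly k))"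

lemma poly_newton_poly:
  "poly (newton_poly m h f x) q = (\<Sum>k\<le>m. (forward_diff h ^^ k) f x * (q gchoose k))"
  by (simp add: newton_poly_def poly_sum poly_binomial_poly)

text \<open>This is the binomial expansion of the \<open>n\<close>th power of the shift by \<open>h\<close>, which is the identity plus
  the difference operator; the induction step is Pascal's rule.\<close>

lemma newton_forward:
  "f (x + of_nat n * h) = (\<Sum>k\<le>n. of_nat (n choose k) * (forward_diff h ^^ k) f x)"
proof (induction n arbitrary: x)
  case 0
  show ?case by simp
next
  case (Suc n)
  define D where "D k = (forward_diff h ^^ k) f x" for k
  have shift: "(forward_diff h ^^ k) f (x + h) = D k + D (Suc k)" for k
    by (simp add: D_def forward_diff_def)
  have "f (x + of_nat (Suc n) * h) = f ((x + h) + of_nat n * h)"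
    by (simp add: algebra_simps)
  also have "\<dots> = (\<Sum>k\<le>n. of_nat (n choose k) * (D k + D (Suc k)))"
    by (simp only: Suc.IH shift)
  also have "\<dots> = (\<Sum>k\<le>n. of_nat (n choose k) * D k) + (\<Sum>k\<le>n. of_nat (n choose k) * D (Suc k))"
    by (simp add: distrib_left sum.distrib)
  also have "(\<Sum>k\<le>n. of_nat (n choose k) * D k) = (\<Sum>k\<le>Suc n. of_nat (n choose k) * D k)"
    by simp
  also have "\<dots> = D 0 + (\<Sum>k\<le>n. of_nat (n choose Suc k) * D (Suc k))"
    by (subst sum.atMost_Suc_shift) simp
  also have "\<dots> + (\<Sum>k\<le>n. of_nat (n choose k) * D (Suc k))
      = (\<Sum>k\<le>Suc n. of_nat (Suc n choose k) * D k)"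
    by (subst sum.atMost_Suc_shift) (simp add: distrib_right sum.distrib)
  finally show ?case by (simp only: D_def)
qed

lemma forward_diff_eq_0_above:
  assumes "\<forall>x. (forward_diff h ^^ Suc m) f x = 0" and "m < k"
  shows "(forward_diff h ^^ k) f x = 0"
  using assms(2)
proof (induction k arbitrary: x)
  case (Suc k)
  show ?case
  proof (cases "k = m")
    case True
    then show ?thesis using assms(1) by blast
  next
    case False
    then have "(forward_diff h ^^ k) f y = 0" for y using Suc by simp
    then show ?thesis by (subst funpow.simps) (simp add: forward_diff_def)
  qed
qed simp

lemma newton_poly_of_nat:
  assumes "\<forall>x. (forward_diff h ^^ Suc m) f x = 0"
  shows "f (x + of_nat n * h) = poly (newton_poly m h f x) (of_nat n)"
proof -
  let ?t = "\<lambda>k. of_nat (n choose k) * (forward_diff h ^^ k) f x"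
  have "f (x + of_nat n * h) = sum ?t {..n}"
    by (rule newton_forward)
  also have "\<dots> = sum ?t {..max n m}"
    by (intro sum.mono_neutral_left) auto
  also have "\<dots> = sum ?t {..m}"
    using forward_diff_eq_0_above[OF assms] by (intro sum.mono_neutral_right) auto
  also have "\<dots> = poly (newton_poly m h f x) (of_nat n)"
    by (simp add: poly_newton_poly binomial_gbinomial mult.commute)
  finally show ?thesis .
qed

lemma poly_eqI_infinite:
  fixes p q :: "real poly"
  assumes "infinite A" and "\<And>x. x \<in> A \<Longrightarrow> poly p x = poly q x"
  shows "p = q"
proof (rule ccontr)
  assume "p \<noteq> q"
  then have "finite {x. poly (p - q) x = 0}" by (intro poly_roots_finite) simp
  moreover have "A \<subseteq> {x. poly (p - q) x = 0}" using assms(2) by auto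
  ultimately show False using assms(1) finite_subset by blast
qed

text \<open>A rational point of the line is reached from a point \<open>x - K * h\<close> in finitely many steps of length
  \<open>h / N\<close>, so the Newton formula with that finer step applies there. Its polynomial agrees with the
  one for step \<open>h\<close> at all natural numbers, hence the two are equal.\<close>

lemma newton_poly_Rats:
  assumes frechet: "\<forall>x h. (forward_diff h ^^ Suc m) f x = 0" and "q \<in> \<rat>"
  shows "f (x + q * h) = poly (newton_poly m h f x) q"
proof -
  obtain i and N :: nat where q: "q = of_int i / of_nat N" and N: "N \<noteq> 0"
    using \<open>q \<in> \<rat>\<close> by (auto simp: Rats_eq_int_div_nat)
  \<comment> \<open>The start is moved back by \<open>K\<close> steps so that \<open>q\<close>, even if negative, does not lie behind it.\<close>
  define K where "K = nat \<bar>i\<bar>"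
  define R where "R = pcompose (newton_poly m (h / of_nat N) f (x - of_nat K * h))
      [:of_nat (K * N), of_nat N:]"
  have fine: "f (x + s * h) = poly R s" if "s * of_nat N + of_nat (K * N) = of_nat n" for s n
  proof -
    have "x + s * h = (x - of_nat K * h) + of_nat n * (h / of_nat N)"
      using N by (simp add: that[symmetric] field_simps)
    then have "f (x + s * h) = poly (newton_poly m (h / of_nat N) f (x - of_nat K * h)) (of_nat n)"
      using newton_poly_of_nat frechet by presburger
    then show ?thesis by (simp add: R_def poly_pcompose that[symmetric] algebra_simps)
  qed
  have "newton_poly m h f x = R"
  proof (rule poly_eqI_infinite)
    show "infinite (range real)"
      using finite_imageD[of real UNIV] by (auto simp: inj_on_def)
    fix s :: real assume "s \<in> range real"
    then obtain j where s: "s = of_nat j" by auto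
    have "f (x + s * h) = poly R s"
      by (rule fine[of _ "j * N + K * N"]) (simp add: s)
    moreover have "f (x + s * h) = poly (newton_poly m h f x) s"
      unfolding s using frechet by (intro newton_poly_of_nat) blast
    ultimately show "poly (newton_poly m h f x) s = poly R s"
      by simp
  qed
  moreover have "f (x + q * h) = poly R q"
  proof (rule fine)
    have "i \<ge> - (int K)" by (simp add: K_def)
    moreover have "int K * 1 \<le> int K * int N" using N by (intro mult_left_mono) auto
    ultimately have "i + int (K * N) \<ge> 0" by simp
    then have "real_of_int i + real (K * N) = real (nat (i + int (K * N)))"
      by (simp add: of_nat_nat)
    then show "q * real N + real (K * N) = real (nat (i + int (K * N)))"
      using N q by simp
  qed
  ultimately show ?thesis by simp
qed

lemma forward_diff_commute: "forward_diff a (forward_diff b f) = forward_diff b (forward_diff a f)"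
  by (rule ext) (simp add: forward_diff_def algebra_simps)

lemma funpow_forward_diff_commute:
  "(forward_diff a ^^ k) ((forward_diff b ^^ l) f) = (forward_diff b ^^ l) ((forward_diff a ^^ k) f)"
proof -
  have *: "forward_diff a ((forward_diff b ^^ l) f) = (forward_diff b ^^ l) (forward_diff a f)" for f
    by (induction l) (simp_all add: forward_diff_commute[of a b])
  show ?thesis by (induction k) (simp_all add: *)
qed

text \<open>Differences of a solution are again solutions, so in the Newton formula with step \<open>1\<close> each
  coefficient, as a function of the base point, can itself be expanded with step \<open>h\<close>.\<close>

lemma frechet_forward_diff:
  assumes "\<forall>x h. (forward_diff h ^^ n) f x = 0"
  shows "\<forall>x h. (forward_diff h ^^ n) ((forward_diff a ^^ k) f) x = 0"
proof -
  have "(forward_diff h ^^ n) f = (\<lambda>_. 0)" for h using assms by auto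
  moreover have "(forward_diff a ^^ k) (\<lambda>_. 0) = (\<lambda>_. 0)"
    by (induction k) (simp_all add: forward_diff_def)
  ultimately show ?thesis by (simp only: funpow_forward_diff_commute[where k = n and l = k]) simp
qed

section \<open>The polynomial expansion along two steps\<close>

text \<open>The polynomial in two variables that extends \<open>f (q + r * h)\<close> from rational to real \<open>q\<close> and \<open>r\<close>:
  Newton's formula in the direction \<open>1\<close>, with each coefficient replaced by its Newton polynomial in
  the direction \<open>h\<close>.\<close>

definition plane_fun :: "nat \<Rightarrow> (real \<Rightarrow> real) \<Rightarrow> real \<Rightarrow> real \<Rightarrow> real \<Rightarrow> real" where
  "plane_fun m f h q r =
     (\<Sum>k\<le>m. poly (newton_poly m h ((forward_diff 1 ^^ k) f) 0) r * (q gchoose k))"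

lemma plane_fun_Rats:
  assumes frechet: "\<forall>x h. (forward_diff h ^^ Suc m) f x = 0" and "q \<in> \<rat>" "r \<in> \<rat>"
  shows "plane_fun m f h q r = f (q + r * h)"
proof -
  have "f (q + r * h) = poly (newton_poly m 1 f (r * h)) q"
    using newton_poly_Rats[OF frechet \<open>q \<in> \<rat>\<close>, of "r * h" 1] by (simp add: add.commute)
  also have "\<dots> = plane_fun m f h q r"
    using newton_poly_Rats[OF frechet_forward_diff[OF frechet] \<open>r \<in> \<rat>\<close>, where x = 0 and h = h]
    by (simp add: poly_newton_poly[of m 1] plane_fun_def)
  finally show ?thesis by simp
qed

lemma plane_fun_0:
  assumes frechet: "\<forall>x h. (forward_diff h ^^ Suc m) f x = 0"
  shows "plane_fun m f h t 0 = poly (newton_poly m 1 f 0) t"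
  using newton_poly_Rats[OF frechet_forward_diff[OF frechet] Rats_0, where x = 0 and h = h]
  by (simp add: poly_newton_poly[of m 1] plane_fun_def)

text \<open>The next two lemmas restrict the extension to lines: to the pairs \<open>(q, r)\<close> with \<open>q + r * h = t\<close>, and
  to the horizontal lines.\<close>

lemma plane_fun_oblique_line:
  "\<exists>p. \<forall>r. plane_fun m f h (t - r * h) r = poly p r"
proof (intro exI allI)
  fix r
  show "plane_fun m f h (t - r * h) r = poly (\<Sum>k\<le>m. newton_poly m h ((forward_diff 1 ^^ k) f) 0
      * pcompose (binomial_poly k) [:t, - h:]) r"
    by (simp add: plane_fun_def poly_sum poly_pcompose poly_binomial_poly)
qed

lemma plane_fun_horizontal_line:
  "\<exists>p. \<forall>t. plane_fun m f h (t + a) r = poly p t"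
proof (intro exI allI)
  fix t
  show "plane_fun m f h (t + a) r = poly (\<Sum>k\<le>m. smult (poly (newton_poly m h ((forward_diff 1 ^^ k) f) 0) r)
      (pcompose (binomial_poly k) [:a, 1:])) t"
    by (simp add: plane_fun_def poly_sum poly_pcompose poly_binomial_poly add.commute)
qed

lemma plane_fun_in_closure:
  assumes frechet: "\<forall>x h. (forward_diff h ^^ Suc m) f x = 0"
  shows "(q + r * h, plane_fun m f h q r) \<in> closure (function_graph f)"
proof -
  define \<Phi> where "\<Phi> z = (fst z + snd z * h, plane_fun m f h (fst z) (snd z))" for z
  have "\<Phi> ` closure (\<rat> \<times> \<rat>) \<subseteq> closure (function_graph f)"
  proof (rule image_closure_subset)
    show "continuous_on (closure (\<rat> \<times> \<rat>)) \<Phi>"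
      unfolding \<Phi>_def plane_fun_def poly_binomial_poly[symmetric]
      by (intro continuous_intros)
    have "\<Phi> z \<in> function_graph f" if "z \<in> \<rat> \<times> \<rat>" for z
      using that by (auto simp: \<Phi>_def function_graph_def plane_fun_Rats[OF frechet])
    then show "\<Phi> ` (\<rat> \<times> \<rat>) \<subseteq> closure (function_graph f)"
      using closure_subset by blast
  qed simp
  moreover have "(q, r) \<in> closure (\<rat> \<times> \<rat>)"
    by (simp add: closure_Times Rats_closure_real)
  ultimately show ?thesis by (force simp: \<Phi>_def)
qed

text \<open>The range of a polynomial is an interval, and if the polynomial is not constant its absolute value
  tends to infinity; an interval that is not bounded contains a half-line from each of its points.\<close>

lemma poly_range_half_line:
  fixes p :: "real poly"
  assumes "poly p a \<noteq> poly p b"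
  shows "{poly p b..} \<subseteq> range (poly p) \<or> {..poly p b} \<subseteq> range (poly p)"
proof -
  have "degree p > 0"
  proof (rule ccontr)
    assume "\<not> degree p > 0"
    then obtain c where "p = [:c:]" by (metis degree_eq_zeroE gr0I)
    then show False using assms by simp
  qed
  then have lim: "filterlim (poly p) at_infinity at_infinity"
    by (intro filterlim_poly_at_infinity)
  have large: "\<exists>x. \<bar>poly p x\<bar> \<ge> B" for B
  proof -
    have "eventually (\<lambda>x. max B 1 \<le> \<bar>poly p x\<bar>) at_infinity"
      using lim[unfolded filterlim_at_infinity[OF order_refl], rule_format, of "max B 1"] by simp
    then show ?thesis by (auto simp: eventually_at_infinity) (metis abs_ge_self)
  qed
  have conn: "is_interval (range (poly p))"
    unfolding is_interval_connected_1
    by (intro connected_continuous_image continuous_intros) simp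
  have mid: "y \<in> range (poly p)" if "poly p u \<le> y" "y \<le> poly p v" for u v y
    using conn that unfolding is_interval_1 by blast
  show ?thesis
  proof (rule ccontr)
    assume "\<not> ?thesis"
    then obtain y z where y: "y \<ge> poly p b" "y \<notin> range (poly p)"
      and z: "z \<le> poly p b" "z \<notin> range (poly p)" by auto
    obtain x where x: "\<bar>poly p x\<bar> \<ge> max \<bar>y\<bar> \<bar>z\<bar>" using large by blast
    show False
    proof (cases "poly p x \<ge> 0")
      case True
      then have "y \<le> poly p x" using x by auto
      then show False using mid y by blast
    next
      case False
      then have "poly p x \<le> z" using x by auto
      then show False using mid z by blast
    qed
  qed
qed

section \<open>Vertical half-lines in the closure of the graph\<close>

text \<open>The sign of \<open>s\<close> selects the direction, upward or downward, of the half-line that starts at the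
  graph of \<open>p\<close>. Treating both directions at once avoids repeating the arguments below for each.\<close>

definition half_line_set :: "(real \<times> real) set \<Rightarrow> real poly \<Rightarrow> real \<Rightarrow> real set" where
  "half_line_set C p s = {t. \<forall>c\<ge>0. (t, poly p t + s * c) \<in> C}"

lemma closed_half_line_set:
  assumes "closed C"
  shows "closed (half_line_set C p s)"
proof -
  have "closed ((\<lambda>t. (t, poly p t + s * c)) -` C)" for c
    using assms by (intro closed_vimage continuous_intros)
  then have "closed (\<Inter>c\<in>{0..}. (\<lambda>t. (t, poly p t + s * c)) -` C)"
    by blast
  moreover have "half_line_set C p s = (\<Inter>c\<in>{0..}. (\<lambda>t. (t, poly p t + s * c)) -` C)"
    by (auto simp: half_line_set_def)
  ultimately show ?thesis by simp
qed

text \<open>The complement of the two sets is open, so if it is not empty it is infinite, and on it the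
  polynomial \<open>r \<mapsto> plane_fun m f h (t - r * h) r\<close> is constant. Since \<open>t\<close> enters polynomially, this
  extends from that set to all \<open>t\<close>, in particular to \<open>t = h\<close>, where it contradicts the choice of \<open>h\<close>.\<close>

lemma half_line_sets_cover:
  assumes frechet: "\<forall>x h. (forward_diff h ^^ Suc m) f x = 0"
    and not_poly: "\<not> ordinary_polynomial f"
  defines "C \<equiv> closure (function_graph f)"
  defines "p \<equiv> newton_poly m 1 f 0"
  shows "half_line_set C p 1 \<union> half_line_set C p (-1) = UNIV"
proof (rule ccontr)
  let ?T = "half_line_set C p 1 \<union> half_line_set C p (-1)"
  assume "?T \<noteq> UNIV"
  moreover have "closed ?T"
    by (intro closed_Un closed_half_line_set) (simp_all add: C_def)
  ultimately have "open (- ?T)" "- ?T \<noteq> {}"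
    unfolding open_closed by (simp_all only: double_complement) blast
  then have inf: "infinite (- ?T)" using finite_imp_closed clopen infinite_UNIV_char_0
    by metis
  obtain h where h: "f h \<noteq> poly p h"
    using not_poly by (auto simp: ordinary_polynomial_def)
  have const: "plane_fun m f h (t - r * h) r = poly p t" if t: "t \<notin> ?T" for t r
  proof (rule ccontr)
    assume neq: "plane_fun m f h (t - r * h) r \<noteq> poly p t"
    obtain g where g: "\<And>r. plane_fun m f h (t - r * h) r = poly g r"
      using plane_fun_oblique_line by metis
    have g0: "poly g 0 = poly p t"
      using g[of 0] plane_fun_0[OF frechet] by (simp add: p_def)
    have sub: "(t, y) \<in> C" if "y \<in> range (poly g)" for y
    proof -
      obtain r where "y = poly g r" using \<open>y \<in> range (poly g)\<close> by blast
      then show ?thesis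
        using plane_fun_in_closure[OF frechet, of "t - r * h" r h] by (simp add: C_def g)
    qed
    have "{poly g 0..} \<subseteq> range (poly g) \<or> {..poly g 0} \<subseteq> range (poly g)"
      using neq g g0 by (intro poly_range_half_line[of _ r]) simp
    then have "t \<in> ?T"
      using sub by (auto simp: half_line_set_def g0 subset_iff)
    with t show False by simp
  qed
  \<comment> \<open>The row \<open>r = 1\<close> is chosen because at \<open>t = h\<close> the point \<open>t - h\<close> is \<open>0\<close>, and \<open>(0, 1)\<close> is a rational pair.\<close>
  obtain g where g: "\<And>t. plane_fun m f h (t + (- h)) 1 = poly g t"
    using plane_fun_horizontal_line by metis
  have "g = p"
    using inf by (rule poly_eqI_infinite) (use const[of _ 1] g in simp)
  then have "plane_fun m f h 0 1 = poly p h" using g[of h] by simp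
  then show False using plane_fun_Rats[OF frechet, of 0 1 h] h by simp
qed

lemma epigraph_open_unbounded:
  assumes "open V" "t \<in> V" "s \<noteq> 0" and V: "V \<subseteq> half_line_set C p s"
  shows "\<exists>U. open U \<and> \<not> bounded U \<and> U \<subseteq> C"
proof (intro exI conjI)
  let ?U = "(V \<times> UNIV) \<inter> {z. 0 < (snd z - poly p (fst z)) / s}"
  show "open ?U"
    using \<open>open V\<close> \<open>s \<noteq> 0\<close>
    by (intro open_Int open_Times open_Collect_less continuous_intros) auto
  show "\<not> bounded ?U"
  proof
    assume "bounded ?U"
    then obtain B where B: "\<And>z. z \<in> ?U \<Longrightarrow> norm z \<le> B" by (auto simp: bounded_iff)
    \<comment> \<open>At this distance the ordinate exceeds \<open>B\<close> in absolute value, whatever the sign of \<open>s\<close>.\<close>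
    define c where "c = (\<bar>poly p t\<bar> + \<bar>B\<bar> + 1) / \<bar>s\<bar>"
    have "c > 0" using \<open>s \<noteq> 0\<close> by (simp add: c_def add_nonneg_pos)
    then have "(t, poly p t + s * c) \<in> ?U" using \<open>t \<in> V\<close> \<open>s \<noteq> 0\<close> by simp
    then have "norm (t, poly p t + s * c) \<le> B" by (rule B)
    then have "\<bar>poly p t + s * c\<bar> \<le> B"
      using norm_snd_le[of "poly p t + s * c" t] by simp
    moreover have "\<bar>s * c\<bar> = \<bar>poly p t\<bar> + \<bar>B\<bar> + 1"
      using \<open>s \<noteq> 0\<close> by (simp add: c_def abs_mult)
    ultimately show False by linarith
  qed
  show "?U \<subseteq> C"
  proof
    fix z assume z: "z \<in> ?U"
    define c where "c = (snd z - poly p (fst z)) / s"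
    have "c \<ge> 0" "z = (fst z, poly p (fst z) + s * c)"
      using z \<open>s \<noteq> 0\<close> by (auto simp: c_def)
    moreover have "fst z \<in> half_line_set C p s" using z V by auto
    ultimately show "z \<in> C" unfolding half_line_set_def by (metis (mono_tags) mem_Collect_eq)
  qed
qed

lemma half_line_interval:
  assumes "t \<in> half_line_set C p s" "s \<noteq> 0"
  shows "\<exists>I. is_interval I \<and> \<not> bounded I \<and> {t} \<times> I \<subseteq> C"
proof (intro exI conjI)
  let ?I = "{y. 0 \<le> (y - poly p t) / s}"
  have eq: "y = poly p t + s * ((y - poly p t) / s)" for y using \<open>s \<noteq> 0\<close> by simp
  show "is_interval ?I"
    using \<open>s \<noteq> 0\<close> by (cases "s > 0") (auto simp: is_interval_1 zero_le_divide_iff)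
  show "\<not> bounded ?I"
  proof
    assume "bounded ?I"
    then obtain B where B: "\<And>y. y \<in> ?I \<Longrightarrow> \<bar>y\<bar> \<le> B" by (auto simp: bounded_iff)
    define c where "c = (\<bar>poly p t\<bar> + \<bar>B\<bar> + 1) / \<bar>s\<bar>"
    have "\<bar>poly p t + s * c\<bar> \<le> B"
      using \<open>s \<noteq> 0\<close> by (intro B) (simp add: c_def)
    moreover have "\<bar>s * c\<bar> = \<bar>poly p t\<bar> + \<bar>B\<bar> + 1"
      using \<open>s \<noteq> 0\<close> by (simp add: c_def abs_mult)
    ultimately show False by linarith
  qed
  show "{t} \<times> ?I \<subseteq> C"
    using assms(1) eq unfolding half_line_set_def by (auto; metis)
qed

text \<open>Above an open set only the part of the graph over that set contributes to the closure, and a closed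
  horizontal strip containing that part contains its closure too.\<close>

lemma bounded_image_imp_bounded_fibre:
  assumes "open J" "t \<in> J" "bounded (f ` J)" "{t} \<times> I \<subseteq> closure (function_graph f)"
  shows "bounded I"
proof -
  obtain B where B: "\<And>y. y \<in> J \<Longrightarrow> \<bar>f y\<bar> \<le> B" using assms(3) by (auto simp: bounded_iff)
  have "\<bar>y\<bar> \<le> B" if "y \<in> I" for y
  proof -
    have "(J \<times> UNIV) \<inter> closure (function_graph f) \<subseteq> closure ((J \<times> UNIV) \<inter> function_graph f)"
      using \<open>open J\<close> by (intro open_Int_closure_subset open_Times) auto
    also have "\<dots> \<subseteq> closure (UNIV \<times> {-B..B})"
      by (intro closure_mono) (use B in \<open>force simp: function_graph_def abs_le_iff\<close>)
    also have "\<dots> = UNIV \<times> {-B..B}" by (simp add: closure_Times)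
    finally have "(t, y) \<in> UNIV \<times> {-B..B}"
      using that assms(2,4) by blast
    then show ?thesis by auto
  qed
  then show ?thesis by (auto simp: bounded_iff)
qed

theorem mainTheorem1:
  fixes m :: nat and f :: "real \<Rightarrow> real"
  assumes frechet: "\<forall>x h. (forward_diff h ^^ (m + 1)) f x = 0"
    and not_poly: "\<not> ordinary_polynomial f"
  shows "(\<forall>J :: real set. is_interval J \<and> open J \<and> J \<noteq> {} \<longrightarrow> \<not> bounded (f ` J))
    \<and> (\<forall>x :: real. \<exists>I :: real set. is_interval I \<and> \<not> bounded I
          \<and> {x} \<times> I \<subseteq> closure (function_graph f))
    \<and> (\<exists>U :: (real \<times> real) set. open U \<and> \<not> bounded U \<and> U \<subseteq> closure (function_graph f))"
proof -
  let ?C = "closure (function_graph f)"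
  define p where "p = newton_poly m 1 f 0"
  have cover: "half_line_set ?C p 1 \<union> half_line_set ?C p (-1) = UNIV"
    unfolding p_def using frechet not_poly by (intro half_line_sets_cover) auto
  have fibre: "\<exists>I. is_interval I \<and> \<not> bounded I \<and> {x} \<times> I \<subseteq> ?C" for x
  proof -
    have "x \<in> half_line_set ?C p 1 \<or> x \<in> half_line_set ?C p (-1)" using cover by auto
    then show ?thesis using half_line_interval by (metis neg_equal_0_iff_equal zero_neq_one)
  qed
  moreover have "\<not> bounded (f ` J)" if J: "open J" "J \<noteq> {}" for J
    using J fibre bounded_image_imp_bounded_fibre by (metis ex_in_conv)
  moreover have "\<exists>U. open U \<and> \<not> bounded U \<and> U \<subseteq> ?C"
  proof (cases "half_line_set ?C p 1 = UNIV")
    case True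
    then show ?thesis using epigraph_open_unbounded[of UNIV 0 1 ?C p] by simp
  next
    case False
    then obtain t where "t \<in> - half_line_set ?C p 1" by blast
    moreover have "open (- half_line_set ?C p 1)"
      by (simp add: closed_half_line_set open_Compl)
    moreover have "- half_line_set ?C p 1 \<subseteq> half_line_set ?C p (-1)" using cover by blast
    ultimately show ?thesis using epigraph_open_unbounded[of _ t "-1" ?C p] by simp
  qed
  ultimately show ?thesis by blast
qed

end
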